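(* For every integer $n\ge 1$, $|\mathcal{S}_n(32;\,3\to 1)| = C_n$, where $C_n=\frac{1}{n+1}\binom{2n}{n}$ is the $n$-th Catalan number.
   Context: $[n]=\{1,\dots,n\}$, and $\mathcal{S}_n$ is the set of permutations $\pi=\pi_1\pi_2\cdots\pi_n$ of $[n]$ in one-line notation. The permutation $\hat\pi$: for $\pi\in\mathcal{S}_n$, $\hat\pi\in\mathcal{S}_n$ is the permutation whose cycle form is obtained from the word $\pi_1\cdots\pi_n$ by inserting a left parenthesis before each left-to-right maximum (an entry larger than all entries to its left) and a right parenthesis immediately before the next left-to-right maximum, or at the end of the word. A cycle $(c_1,c_2,\dots,c_s)$ means $c_1\mapsto c_2\mapsto\cdots\mapsto c_s\mapsto c_1$. Example: if $\pi=2537164$ then $\hat\pi=(2)(53)(7164)$. Arrow patterns: an arrow pattern of size $k$ is a pair $(\nu;H)$ where $\nu=\nu_1\cdots\nu_m$ is a word of distinct positive integers, $H$ is a collection of arrows $b_i\to c_i$, and the set of all integers appearing in $\nu$ or $H$ is $[k]$. A permutation $\pi\in\mathcal{S}_n$ contains $(\nu;H)$ if there are a set $X=\{x_1<x_2<\cdots<x_k\}\subseteq[n]$ and indices $t_1<\cdots<t_m$ such that $\pi_{t_1}\pi_{t_2}\cdots\pi_{t_m}=x_{\nu_1}x_{\nu_2}\cdots x_{\nu_m}$ and $\hat\pi(x_{b_i})=x_{c_i}$ for every arrow $b_i\to c_i$ in $H$. Otherwise $\pi$ avoids $(\nu;H)$. $\mathcal{S}_n(\nu;H)$ is the set of permutations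 in $\mathcal{S}_n$ avoiding $(\nu;H)$. *)

theory Defs
  imports Complex_Main "HOL-Combinatorics.Combinatorics"
begin

text \<open>
  A permutation of \<open>{1..n}\<close> in one-line notation is a list in \<^term>\<open>permutations_of_set {1..n}\<close>;
  the entry written $\pi_i$ is \<open>\<pi> ! (i - 1)\<close>, since list positions start at 0.
\<close>

definition left_to_right_max :: "nat list \<Rightarrow> nat \<Rightarrow> bool" where
  "left_to_right_max \<pi> i \<longleftrightarrow> i < length \<pi> \<and> (\<forall>j<i. \<pi> ! j < \<pi> ! i)"

text \<open>
  The parenthesised blocks of a word. In a word of distinct numbers the left-to-right maximum that
  follows a left-to-right maximum \<open>x\<close> is the first later entry that exceeds \<open>x\<close>.
\<close>

function cycle_blocks :: "nat list \<Rightarrow> nat list list" where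
  "cycle_blocks [] = []"
| "cycle_blocks (x # xs) =
     (x # takeWhile (\<lambda>y. y < x) xs) # cycle_blocks (dropWhile (\<lambda>y. y < x) xs)"
  by pat_completeness auto
termination
  by (relation "measure length") (auto simp: less_Suc_eq_le length_dropWhile_le)

lemma concat_cycle_blocks: "concat (cycle_blocks \<pi>) = \<pi>"
  by (induction \<pi> rule: cycle_blocks.induct) auto

lemma set_hd_cycle_blocks: "hd ` set (cycle_blocks \<pi>) \<subseteq> set \<pi>"
  by (induction \<pi> rule: cycle_blocks.induct) (auto dest: set_dropWhileD)

lemma hd_cycle_blocks_iff_left_to_right_max:
  assumes "distinct \<pi>" "i < length \<pi>"
  shows "\<pi> ! i \<in> hd ` set (cycle_blocks \<pi>) \<longleftrightarrow> left_to_right_max \<pi> i"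
  using assms
proof (induction \<pi> arbitrary: i rule: cycle_blocks.induct)
  case 1
  then show ?case by simp
next
  case (2 x xs)
  define A where "A = takeWhile (\<lambda>y. y < x) xs"
  define B where "B = dropWhile (\<lambda>y. y < x) xs"
  have xs: "xs = A @ B" by (simp add: A_def B_def)
  have A: "\<forall>y\<in>set A. y < x" unfolding A_def by (auto dest: set_takeWhileD)
  have B: "x < B ! 0" if "B \<noteq> []"
  proof -
    have "\<not> hd B < x" using that unfolding B_def by (rule hd_dropWhile)
    moreover have "B ! 0 \<in> set B" "hd B = B ! 0" using that by (auto simp: hd_conv_nth)
    moreover have "x \<notin> set B" using 2(2) xs by auto
    ultimately show ?thesis by (metis linorder_neqE_nat)
  qed
  have dist: "distinct B" "set A \<inter> set B = {}" "x \<notin> set B" using 2(2) xs by auto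
  have heads: "hd ` set (cycle_blocks (x # xs)) = insert x (hd ` set (cycle_blocks B))"
    by (simp add: B_def)
  have sub: "hd ` set (cycle_blocks B) \<subseteq> set B" by (rule set_hd_cycle_blocks)
  consider "i = 0" | "0 < i" "i \<le> length A" | k where "i = Suc (length A + k)" "k < length B"
  proof -
    assume a: "i = 0 \<Longrightarrow> thesis" "0 < i \<Longrightarrow> i \<le> length A \<Longrightarrow> thesis"
      "\<And>k. i = Suc (length A + k) \<Longrightarrow> k < length B \<Longrightarrow> thesis"
    show thesis
      using a(1,2) a(3)[of "i - Suc (length A)"] 2(3) xs by (cases "i \<le> length A") auto
  qed
  then show ?case
  proof cases
    case 1
    then show ?thesis by (simp add: left_to_right_max_def)
  next
    case 2
    then have i: "(x # xs) ! i \<in> set A" using xs by (cases i) (auto simp: nth_append)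
    then have "\<not> left_to_right_max (x # xs) i"
      using A 2 unfolding left_to_right_max_def by (metis nth_Cons_0 order.asym)
    moreover have "(x # xs) ! i \<notin> hd ` set (cycle_blocks (x # xs))"
    proof -
      have "(x # xs) ! i \<noteq> x" using i A by auto
      moreover have "(x # xs) ! i \<notin> set B" using i dist(2) by auto
      ultimately show ?thesis using sub unfolding heads by auto
    qed
    ultimately show ?thesis by simp
  next
    case (3 k)
    have nth: "(x # xs) ! i = B ! k" using 3 xs by (simp add: nth_append)
    have nB: "(x # xs) ! Suc (length A + j) = B ! j" for j using xs by (simp add: nth_append)
    have "left_to_right_max (x # xs) i \<longleftrightarrow> left_to_right_max B k"
    proof
      assume l: "left_to_right_max (x # xs) i"
      have "B ! j < B ! k" if "j < k" for j
        using l that 3 nB[of j] nth unfolding left_to_right_max_def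
        by (metis Suc_less_eq nat_add_left_cancel_less)
      then show "left_to_right_max B k" using 3 by (simp add: left_to_right_max_def)
    next
      assume l: "left_to_right_max B k"
      have "B \<noteq> []" using 3 by auto
      then have "x < B ! 0" by (rule B)
      moreover have "B ! 0 \<le> B ! k"
        using l unfolding left_to_right_max_def by (cases "k = 0") (auto intro: less_imp_le)
      ultimately have xk: "x < B ! k" by (rule less_le_trans)
      have "(x # xs) ! j < B ! k" if "j < i" for j
      proof (cases "j \<le> length A")
        case True
        then have "(x # xs) ! j \<in> insert x (set A)" using xs by (cases j) (auto simp: nth_append)
        then show ?thesis using A xk by auto
      next
        case False
        then obtain m where m: "j = Suc (length A + m)"
          by (metis Suc_le_eq add_Suc le_Suc_ex linorder_not_le)
        then have "m < k" using that 3 by simp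
        then show ?thesis using l m nB[of m] by (simp add: left_to_right_max_def)
      qed
      then show "left_to_right_max (x # xs) i"
        using 3 nth xs by (simp add: left_to_right_max_def)
    qed
    moreover have "B ! k \<noteq> x" using dist 3 by (metis nth_mem)
    moreover have "B ! k \<in> hd ` set (cycle_blocks B) \<longleftrightarrow> left_to_right_max B k"
      using "2.IH"[of k] dist 3 by (simp add: B_def)
    ultimately show ?thesis using nth heads by simp
  qed
qed

text \<open>
  \<^term>\<open>cycle_of_list [c\<^sub>1, c\<^sub>2, c\<^sub>3]\<close> maps $c_1 \mapsto c_2 \mapsto c_3 \mapsto c_1$. The blocks of a
  permutation are disjoint, so the order of composition is immaterial.
\<close>

definition hat :: "nat list \<Rightarrow> nat \<Rightarrow> nat" where
  "hat \<pi> = foldr (\<circ>) (map cycle_of_list (cycle_blocks \<pi>)) id"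

lemma "cycle_blocks [2, 5, 3, 7, 1, 6, 4] = [[2], [5, 3], [7, 1, 6, 4]]"
  by simp

lemma "map (hat [2, 5, 3, 7, 1, 6, 4]) [1, 2, 3, 4, 5, 6, 7] = [6, 2, 5, 7, 3, 4, 1]"
  by (simp add: hat_def transpose_def)

text \<open>An arrow \<open>b \<rightarrow> c\<close> is encoded as the pair \<open>(b, c)\<close>.\<close>

type_synonym arrow_pattern = "nat list \<times> (nat \<times> nat) set"

fun arrow_pattern_of_size :: "nat \<Rightarrow> arrow_pattern \<Rightarrow> bool" where
  "arrow_pattern_of_size k (\<nu>, H) \<longleftrightarrow>
     distinct \<nu> \<and> set \<nu> \<union> fst ` H \<union> snd ` H = {1..k}"

fun pattern_size :: "arrow_pattern \<Rightarrow> nat" where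
  "pattern_size (\<nu>, H) = card (set \<nu> \<union> fst ` H \<union> snd ` H)"

lemma pattern_size_eq: "arrow_pattern_of_size k P \<Longrightarrow> pattern_size P = k"
  by (cases P) simp

lemma "arrow_pattern_of_size 3 ([3, 2], {(3, 1)})"
  by auto

text \<open>
  The set \<open>X = {x\<^sub>1 < \<dots> < x\<^sub>k}\<close> is given by its increasing enumeration \<open>x\<close> on \<open>{1..k}\<close>,
  and \<open>t\<close> is the increasing sequence of positions of the occurrence of \<open>\<nu>\<close>.
\<close>

fun contains_arrow_pattern :: "nat list \<Rightarrow> arrow_pattern \<Rightarrow> bool" where
  "contains_arrow_pattern \<pi> (\<nu>, H) \<longleftrightarrow>
     (\<exists>x t. strict_mono_on {1..pattern_size (\<nu>, H)} x
          \<and> x ` {1..pattern_size (\<nu>, H)} \<subseteq> {1..length \<pi>}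
          \<and> strict_mono_on {..<length \<nu>} t
          \<and> t ` {..<length \<nu>} \<subseteq> {..<length \<pi>}
          \<and> (\<forall>j<length \<nu>. \<pi> ! t j = x (\<nu> ! j))
          \<and> (\<forall>(b, c)\<in>H. hat \<pi> (x b) = x c))"

definition arrow_avoiders :: "nat \<Rightarrow> arrow_pattern \<Rightarrow> nat list set" where
  "arrow_avoiders n P = {\<pi> \<in> permutations_of_set {1..n}. \<not> contains_arrow_pattern \<pi> P}"

definition catalan :: "nat \<Rightarrow> real" where
  "catalan n = 1 / (real n + 1) * real ((2 * n) choose n)"

end

theory Submission
  imports Defs "HOL-Library.Sublist" "HOL-Computational_Algebra.Formal_Power_Series"
begin

text \<open>
  If \<open>hat \<pi> c = a\<close> with \<open>a < c\<close>, then \<open>c\<close> is not the last entry of its block, since the last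
  entry is mapped to the maximum of the block. So \<open>a\<close> immediately follows \<open>c\<close> in \<open>\<pi>\<close>, and
  conversely both entries of a descent lie in the same block. The arrow pattern is therefore the
  vincular pattern 31-2, which is avoided exactly when the classical pattern 312 is. A 312-avoider
  has the form \<open>A @ m # B\<close>, where \<open>m\<close> is its minimum, \<open>A\<close> and \<open>B\<close> avoid 312 and every entry of \<open>A\<close>
  is smaller than every entry of \<open>B\<close>, which yields the Catalan recurrence.
\<close>

section \<open>The recurrence of the Catalan numbers\<close>

lemma catalan_0: "catalan 0 = 1"
  by (simp add: catalan_def)

text \<open>Two uses of the absorption identity lead from \<open>(2 * n) choose n\<close> through
  \<open>(2 * n + 1) choose n\<close> to the next central binomial coefficient. Read
  coefficientwise, this recurrence is a differential equation for the generating function.\<close>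

lemma catalan_Suc: "(real n + 2) * catalan (Suc n) = (4 * real n + 2) * catalan n"
proof -
  define b0 b1 b2 where "b0 = real ((2 * n) choose n)" and "b1 = real ((2 * n + 1) choose n)"
    and "b2 = real ((2 * n + 2) choose Suc n)"
  \<comment> \<open>Absorption yields the lower index \<open>Suc n\<close>; symmetry brings it back
    to \<open>n\<close>, so that both uses meet at \<open>b1\<close>.\<close>
  have sym: "(2 * n + 1) choose Suc n = (2 * n + 1) choose n"
    using binomial_symmetric[of n "2 * n + 1"] by simp
  have "Suc n * ((2 * n + 1) choose Suc n) = (2 * n + 1) * ((2 * n) choose n)"
    using Suc_times_binomial_eq[of "2 * n" n] by (simp add: mult.commute)
  then have "real (Suc n * ((2 * n + 1) choose n)) = real ((2 * n + 1) * ((2 * n) choose n))"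
    unfolding sym by presburger
  then have 1: "(real n + 1) * b1 = (2 * real n + 1) * b0"
    unfolding b0_def b1_def of_nat_mult by (simp add: add.commute)
  have "Suc n * ((2 * n + 2) choose Suc n) = (2 * n + 2) * ((2 * n + 1) choose n)"
    using Suc_times_binomial_eq[of "2 * n + 1" n] by (simp add: mult.commute)
  then have "real (Suc n * ((2 * n + 2) choose Suc n)) = real ((2 * n + 2) * ((2 * n + 1) choose n))"
    by presburger
  then have 2: "(real n + 1) * b2 = (2 * real n + 2) * b1"
    unfolding b1_def b2_def of_nat_mult by (simp add: add.commute)
  have "(real n + 1) * b2 = (4 * real n + 2) * b0"
    using 1 2 by (simp add: algebra_simps)
  then have "b2 = (4 * real n + 2) * (b0 / (real n + 1))"
    by (simp add: field_simps)
  moreover have "catalan n = b0 / (real n + 1)" "catalan (Suc n) = b2 / (real n + 2)"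
    by (simp_all add: catalan_def b0_def b2_def add.commute)
  ultimately show ?thesis
    by simp
qed

text \<open>With \<open>F\<close> the generating function, \<open>S = 1 - 2 * fps_X * F\<close>
  should be the square root of \<open>1 - 4 * fps_X\<close>. The recurrence gives \<open>S\<close> a
  linear differential equation, so \<open>S * S\<close> satisfies the one solved by
  \<open>1 - 4 * fps_X\<close>. Its coefficients from degree 2 on vanish, which is the convolution
  formula.\<close>

lemma catalan_convolution: "catalan (Suc n) = (\<Sum>i\<le>n. catalan i * catalan (n - i))"
proof -
  define F where "F = Abs_fps catalan"
  define S where "S = 1 - 2 * fps_X * F"
  have S_0: "fps_nth S 0 = 1" and S_Suc: "fps_nth S (Suc k) = - 2 * catalan k" for k
    by (simp_all add: S_def F_def mult.assoc numeral_fps_const)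
  have S': "(1 - 4 * fps_X) * fps_deriv S = - 2 * S"
  proof (rule fps_ext)
    fix k
    show "fps_nth ((1 - 4 * fps_X) * fps_deriv S) k = fps_nth (- 2 * S) k"
    proof (cases k)
      case 0
      then show ?thesis
        by (simp add: left_diff_distrib mult.assoc numeral_fps_const S_0 S_Suc catalan_0 fps_const_neg[symmetric] del: fps_const_neg)
    next
      case (Suc j)
      have "fps_nth ((1 - 4 * fps_X) * fps_deriv S) k
          = (real j + 2) * (- 2 * catalan (Suc j)) - 4 * ((real j + 1) * (- 2 * catalan j))"
        by (simp add: left_diff_distrib mult.assoc numeral_fps_const S_Suc Suc add.commute)
      also have "\<dots> = 4 * catalan j"
        using catalan_Suc[of j] by argo
      also have "\<dots> = fps_nth (- 2 * S) k"
        by (simp add: Suc S_Suc numeral_fps_const)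
      finally show ?thesis .
    qed
  qed
  have "(1 - 4 * fps_X) * fps_deriv (S * S) = 2 * S * ((1 - 4 * fps_X) * fps_deriv S)"
    by (simp add: algebra_simps)
  also have "\<dots> = - 4 * (S * S)"
    unfolding S' by (simp add: algebra_simps)
  finally have T': "(1 - 4 * fps_X) * fps_deriv (S * S) = - 4 * (S * S)" .
  define T where "T = S * S"
  \<comment> \<open>Compare coefficients of degree \<open>k\<close>. The factor
    \<open>real k - 1\<close> vanishes at \<open>k = 1\<close>, which kills degree 2 and then every
    higher degree.\<close>
  have T: "(real k + 1) * fps_nth T (Suc k) = 4 * (real k - 1) * fps_nth T k" for k
    using arg_cong[OF T'[folded T_def], of "\<lambda>f. fps_nth f k"]
    by (cases k) (simp_all add: left_diff_distrib mult.assoc numeral_fps_const algebra_simps)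
  have "fps_nth T (Suc (Suc k)) = 0" for k
  proof (induction k)
    case 0
    then show ?case using T[of 1] by simp
  next
    case (Suc k)
    then show ?case using T[of "Suc (Suc k)"] by simp
  qed
  then have "fps_nth T (Suc (Suc n)) = 0" .
  \<comment> \<open>In degree \<open>n + 2\<close> this leaves -4 times coefficient
    \<open>n + 1\<close> of \<open>F\<close> plus 4 times coefficient \<open>n\<close> of
    \<open>F * F\<close>.\<close>
  moreover have "T = 1 - 4 * (fps_X * F) + 4 * (fps_X * (fps_X * (F * F)))"
    by (simp add: T_def S_def algebra_simps)
  ultimately have "fps_nth F (Suc n) = fps_nth (F * F) n"
    by (simp add: numeral_fps_const)
  then show ?thesis
    by (simp add: F_def fps_mult_nth atLeast0AtMost)
qed

section \<open>Permutations avoiding 312\<close>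

definition avoids_312 :: "'a::linorder list \<Rightarrow> bool" where
  "avoids_312 xs \<longleftrightarrow> (\<forall>c a b. subseq [c, a, b] xs \<longrightarrow> \<not> (a < b \<and> b < c))"

lemma avoids_312_subseq: "subseq xs ys \<Longrightarrow> avoids_312 ys \<Longrightarrow> avoids_312 xs"
  unfolding avoids_312_def by (blast intro: subseq_order.trans)

lemma subseq_imp_set_subset: "subseq xs ys \<Longrightarrow> set xs \<subseteq> set ys"
  by (induction rule: list_emb.induct) auto

text \<open>An entry of \<open>A\<close> above an entry of \<open>B\<close> would form 312 with
  \<open>m\<close> between them. Conversely, an occurrence not inside \<open>A\<close> or
  \<open>B\<close> would have its 3 in \<open>A\<close> and its 2 in \<open>B\<close>, against the
  order of the two halves.\<close>

lemma avoids_312_append_min_iff: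
  assumes "\<And>x. x \<in> set A \<union> set B \<Longrightarrow> m < x"
  shows "avoids_312 (A @ m # B) \<longleftrightarrow>
    avoids_312 A \<and> avoids_312 B \<and> (\<forall>x\<in>set A. \<forall>y\<in>set B. x \<le> y)"
proof
  assume av: "avoids_312 (A @ m # B)"
  have "avoids_312 A" "avoids_312 B"
    by (auto intro!: avoids_312_subseq[OF _ av])
  moreover have "x \<le> y" if "x \<in> set A" "y \<in> set B" for x y
  proof -
    have "subseq ([x] @ [m, y]) (A @ m # B)"
      using that by (intro list_emb_append_mono) (auto simp: subseq_singleton_left)
    then have "\<not> (m < y \<and> y < x)"
      using av by (simp add: avoids_312_def)
    then show ?thesis
      using assms[of y] that by auto
  qed
  ultimately show "avoids_312 A \<and> avoids_312 B \<and> (\<forall>x\<in>set A. \<forall>y\<in>set B. x \<le> y)"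
    by blast
next
  assume av: "avoids_312 A \<and> avoids_312 B \<and> (\<forall>x\<in>set A. \<forall>y\<in>set B. x \<le> y)"
  show "avoids_312 (A @ m # B)"
    unfolding avoids_312_def
  proof (intro allI impI notI)
    fix c a b
    assume sub: "subseq [c, a, b] (A @ m # B)" and ab: "a < b \<and> b < c"
    obtain us vs where uv: "[c, a, b] = us @ vs" "subseq us A" "subseq vs (m # B)"
      using sub by (auto simp: subseq_append_iff)
    have mem: "set us \<subseteq> set A" "set vs \<subseteq> insert m (set B)"
      using uv(2,3)[THEN subseq_imp_set_subset] by simp_all
    \<comment> \<open>The cut between \<open>A\<close> and \<open>m # B\<close> falls before, inside
      or after the occurrence. If inside, \<open>b\<close> exceeds \<open>a\<close>, hence
      \<open>m\<close>, and so lies in \<open>B\<close>.\<close>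
    consider "us = []" "vs = [c, a, b]" | "c \<in> set us" "b \<in> set vs" | "us = [c, a, b]"
      using uv(1) by (auto simp: Cons_eq_append_conv)
    then show False
    proof cases
      case 1
      then have s: "subseq [c, a, b] (m # B)" using uv(3) by simp
      show ?thesis
      proof (cases "c = m")
        case True
        then have "b \<in> set B"
          using s subseq_imp_set_subset[of "[a, b]" B] by simp
        then show ?thesis using assms[of b] ab True by auto
      next
        case False
        then show ?thesis using s av ab by (auto simp: avoids_312_def)
      qed
    next
      case 2
      have "a \<in> set us \<union> set vs"
        using uv(1) by (metis list.set_intros set_append)
      then have "a = m \<or> m < a"
        using mem assms[of a] by auto
      then have "b \<in> set B"
        using 2 mem(2) ab by auto
      then show ?thesis
        using 2 mem(1) ab av by (auto simp: not_le[symmetric])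
    next
      case 3
      then show ?thesis using uv(2) av ab by (auto simp: avoids_312_def)
    qed
  qed
qed

section \<open>Decomposition at the minimum and the number of 312-avoiders\<close>

definition avoiders_312 :: "'a::linorder set \<Rightarrow> 'a list set" where
  "avoiders_312 S = {xs \<in> permutations_of_set S. avoids_312 xs}"

lemma finite_avoiders_312: "finite (avoiders_312 S)"
  by (simp add: avoiders_312_def)

text \<open>The only freedom is the point of the cut, namely \<open>Min U\<close>, or the right end
  if \<open>U\<close> is empty; the size of \<open>L\<close> determines it.\<close>

lemma interval_split:
  fixes p q :: nat
  assumes "L \<union> U = {p..<q}" "\<And>x y. x \<in> L \<Longrightarrow> y \<in> U \<Longrightarrow> x < y"
  shows "L = {p..<p + card L}" "U = {p + card L..<q}"
proof -
  obtain u where u: "L = {p..<u}" "U = {u..<q}" "p \<le> u"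
  proof (cases "U = {}")
    case True
    \<comment> \<open>The maximum covers \<open>q < p\<close>, where the interval is empty but the
      cut must still be at least \<open>p\<close>.\<close>
    then show ?thesis using assms(1) by (intro that[of "max p q"]) (auto simp: max_def)
  next
    case False
    have fin: "finite U" using assms(1) by (metis finite_Un finite_atLeastLessThan)
    define u where "u = Min U"
    have u: "u \<in> U" "\<And>y. y \<in> U \<Longrightarrow> u \<le> y"
      using False fin by (simp_all add: u_def)
    show ?thesis
    proof (rule that[of u])
      show "p \<le> u" using u assms(1) by auto
      have "u < q" using u assms(1) by auto
      have L: "x \<in> L \<longleftrightarrow> x < u \<and> x \<notin> U" if "x \<in> {p..<q}" for x
        using that assms u by (metis UnE linorder_not_le)
      have sub: "L \<subseteq> {p..<q}" "U \<subseteq> {p..<q}" using assms(1) by blast+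
      have U: "x \<in> U \<longleftrightarrow> u \<le> x" if "x \<in> {p..<q}" for x
        using L[OF that] that assms(1) u(2) by (metis UnE linorder_not_le)
      show "L = {p..<u}"
      proof (intro set_eqI iffI)
        fix x assume "x \<in> L"
        then show "x \<in> {p..<u}" using sub L[of x] by auto
      next
        fix x assume x: "x \<in> {p..<u}"
        then have "x \<in> {p..<q}" using \<open>u < q\<close> by auto
        then show "x \<in> L" using L U x by auto
      qed
      show "U = {u..<q}"
      proof (intro set_eqI iffI)
        fix x assume "x \<in> U"
        then show "x \<in> {u..<q}" using sub u(2) by auto
      next
        fix x assume x: "x \<in> {u..<q}"
        then have "x \<in> {p..<q}" using \<open>p \<le> u\<close> by auto
        then show "x \<in> U" using U x by auto
      qed
    qed
  qed
  then show "L = {p..<p + card L}" "U = {p + card L..<q}" by auto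
qed

text \<open>Here \<open>i\<close> is the length of \<open>A\<close>, which takes the
  \<open>i\<close> smallest values above \<open>m\<close>. The upper bounds are written as start
  plus length, the shape in which the induction hypothesis of the count applies.\<close>

lemma avoiders_312_interval:
  "avoiders_312 {m..<m + Suc n} =
    (\<Union>i\<le>n. (\<lambda>(A, B). A @ m # B) `
      (avoiders_312 {Suc m..<Suc m + i} \<times> avoiders_312 {Suc m + i..<Suc m + i + (n - i)}))"
  (is "?L = ?R")
proof
  show "?L \<subseteq> ?R"
  proof
    fix xs assume "xs \<in> ?L"
    then have xs: "set xs = {m..<m + Suc n}" "distinct xs" "avoids_312 xs"
      by (auto simp: avoiders_312_def permutations_of_set_def)
    then obtain A B where AB: "xs = A @ m # B"
      using split_list[of m xs] by auto
    have un: "set A \<union> set B = {Suc m..<Suc m + n}"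
    proof -
      have "set A \<union> set B = set xs - {m}" using xs(2) unfolding AB by auto
      also have "\<dots> = {Suc m..<Suc m + n}" unfolding xs(1) by auto
      finally show ?thesis .
    qed
    then have "m < x" if "x \<in> set A \<union> set B" for x using that by auto
    from avoids_312_append_min_iff[OF this, THEN iffD1, OF _ xs(3)[unfolded AB]]
    have av: "avoids_312 A" "avoids_312 B" "\<forall>x\<in>set A. \<forall>y\<in>set B. x \<le> y"
      by simp_all
    have "x < y" if "x \<in> set A" "y \<in> set B" for x y
      using that av(3) xs(2) by (metis AB distinct_append disjoint_iff insert_iff list.simps(15) order.strict_iff_order)
    note split = interval_split[OF un this]
    \<comment> \<open>This makes the truncated difference \<open>n - card (set A)\<close> genuine,
      so that the upper interval ends at \<open>Suc m + n\<close>.\<close>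
    have len: "card (set A) \<le> n"
      using card_mono[OF _ Un_upper1[of "set A" "set B", unfolded un]] by simp
    then have "set A = {Suc m..<Suc m + card (set A)}"
      "set B = {Suc m + card (set A)..<Suc m + card (set A) + (n - card (set A))}"
      using split by simp_all
    then have "A \<in> avoiders_312 {Suc m..<Suc m + card (set A)}"
      "B \<in> avoiders_312 {Suc m + card (set A)..<Suc m + card (set A) + (n - card (set A))}"
      using xs(2) av by (simp_all add: avoiders_312_def permutations_of_set_def AB)
    then show "xs \<in> ?R"
      using len AB by (intro UN_I[of "card (set A)"] image_eqI[of _ _ "(A, B)"]) simp_all
  qed
next
  show "?R \<subseteq> ?L"
  proof
    fix xs assume "xs \<in> ?R"
    then obtain i A B where i: "i \<le> n" and xs: "xs = A @ m # B"
      and "A \<in> avoiders_312 {Suc m..<Suc m + i}"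
      and "B \<in> avoiders_312 {Suc m + i..<Suc m + i + (n - i)}"
      by (auto simp del: add_Suc)
    then have AB: "set A = {Suc m..<Suc m + i}" "set B = {Suc m + i..<Suc m + i + (n - i)}"
        "distinct A" "distinct B" "avoids_312 A" "avoids_312 B"
      unfolding avoiders_312_def permutations_of_set_def by blast+
    have "m < x" if "x \<in> set A \<union> set B" for x
      using that AB(1,2) by auto
    moreover have less: "x < y" if "x \<in> set A" "y \<in> set B" for x y
      using that AB(1,2) by simp
    ultimately have "avoids_312 xs"
      using AB(5,6) unfolding xs by (subst avoids_312_append_min_iff) (auto intro: less_imp_le)
    moreover have "set xs = {m..<m + Suc n}"
      using i unfolding xs set_append list.set AB(1,2) by auto
    moreover have "set A \<inter> set B = {}" "m \<notin> set A" "m \<notin> set B"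
      using AB(1,2) less by auto
    then have "distinct xs"
      using AB(3,4) by (simp add: xs)
    ultimately show "xs \<in> ?L"
      by (simp add: avoiders_312_def permutations_of_set_def)
  qed
qed

text \<open>Strong induction with arbitrary \<open>m\<close>, since the two halves live on shifted
  intervals; the disjoint union over \<open>i\<close> gives the Catalan convolution.\<close>

lemma card_avoiders_312: "real (card (avoiders_312 {m..<m + n})) = catalan n"
proof (induction n arbitrary: m rule: less_induct)
  case (less n)
  show ?case
  proof (cases n)
    case 0
    then show ?thesis by (simp add: avoiders_312_def avoids_312_def catalan_0 Collect_conv_if)
  next
    case (Suc k)
    define P where "P i = avoiders_312 {Suc m..<Suc m + i} \<times> 
      avoiders_312 {Suc m + i..<Suc m + i + (k - i)}" for i
    define join where "join = (\<lambda>(A, B). A @ m # B)"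
    have mem: "m \<notin> set A" "m \<notin> set B" "length A = i" if "(A, B) \<in> P i" for A B i
      using that by (auto simp: P_def avoiders_312_def permutations_of_set_def dest: distinct_card)
    \<comment> \<open>As \<open>m\<close> occurs in neither half, the joined word determines both
      halves, and the length of the first determines the index. This gives injectivity of
      \<open>join\<close> on each \<open>P i\<close> and disjointness of the images.\<close>
    have inj: "p = q \<and> i = j" if "p \<in> P i" "q \<in> P j" "join p = join q" for p q i j
    proof -
      obtain A B A' B' where pq: "p = (A, B)" "q = (A', B')" by fastforce
      have "A @ m # B = A' @ m # B'" using that(3) by (simp add: pq join_def)
      moreover have "m \<notin> set A" "m \<notin> set B" using mem that(1,2) pq by blast+
      ultimately have "A = A'" "B = B'"
        by (simp_all add: append_Cons_eq_iff)
      then show ?thesis using mem(3) that(1,2) pq by metis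
    qed
    have "card (avoiders_312 {m..<m + n}) = card (\<Union>i\<le>k. join ` P i)"
      by (simp only: Suc avoiders_312_interval P_def join_def)
    also have "\<dots> = (\<Sum>i\<le>k. card (join ` P i))"
    proof (rule card_UN_disjoint)
      show "\<forall>i\<in>{..k}. finite (join ` P i)"
        by (simp add: P_def finite_avoiders_312)
      show "\<forall>i\<in>{..k}. \<forall>j\<in>{..k}. i \<noteq> j \<longrightarrow> join ` P i \<inter> join ` P j = {}"
        using inj by blast
    qed simp
    also have "\<dots> = (\<Sum>i\<le>k. card (P i))"
      by (intro sum.cong refl card_image inj_onI) (use inj in blast)
    finally have "real (card (avoiders_312 {m..<m + n})) = (\<Sum>i\<le>k. real (card (P i)))"
      by simp
    also have "\<dots> = (\<Sum>i\<le>k. catalan i * catalan (k - i))"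
    proof (intro sum.cong refl)
      fix i assume "i \<in> {..k}"
      then have "i < n" "k - i < n" using Suc by auto
      then show "real (card (P i)) = catalan i * catalan (k - i)"
        by (simp only: P_def card_cartesian_product of_nat_mult less.IH)
    qed
    also have "\<dots> = catalan n"
      by (simp add: Suc catalan_convolution)
    finally show ?thesis .
  qed
qed

text \<open>Keep \<open>b\<close> fixed. Between \<open>c\<close> and \<open>a\<close> the word
  passes from values above \<open>b\<close> to values below it without taking the value
  \<open>b\<close>, so some adjacent pair makes the jump.\<close>

lemma ex_subseq_312_iff_vincular:
  fixes xs :: "'a::linorder list"
  assumes "distinct xs"
  shows "(\<exists>c a b. subseq [c, a, b] xs \<and> a < b \<and> b < c) \<longleftrightarrow>
    (\<exists>us c a vs b. xs = us @ c # a # vs \<and> b \<in> set vs \<and> a < b \<and> b < c)"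
proof
  assume "\<exists>us c a vs b. xs = us @ c # a # vs \<and> b \<in> set vs \<and> a < b \<and> b < c"
  then obtain us c a vs b where xs: "xs = us @ c # a # vs" "b \<in> set vs" "a < b" "b < c"
    by blast
  then have "subseq [c, a, b] xs"
    by (auto simp: subseq_singleton_left)
  then show "\<exists>c a b. subseq [c, a, b] xs \<and> a < b \<and> b < c"
    using xs by blast
next
  assume "\<exists>c a b. subseq [c, a, b] xs \<and> a < b \<and> b < c"
  then obtain c a b where "subseq [c, a, b] xs" "a < b" "b < c"
    by blast
  then show "\<exists>us c a vs b. xs = us @ c # a # vs \<and> b \<in> set vs \<and> a < b \<and> b < c"
    using assms
  proof (induction xs arbitrary: c a rule: list.induct)
    case Nil
    then show ?case by simp
  next
    case (Cons x xs)
    have shift: ?case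
      if "\<exists>us c a vs b. xs = us @ c # a # vs \<and> b \<in> set vs \<and> a < b \<and> b < c"
      using that by (metis append_Cons)
    show ?case
    proof (cases "subseq [c, a, b] xs")
      case True
      then show ?thesis using Cons shift by auto
    next
      case False
      then have c: "x = c" and ab: "subseq [a, b] xs"
        using Cons.prems(1) by (auto split: if_splits)
      then obtain y ys where xs: "xs = y # ys" by (cases xs) auto
      \<comment> \<open>The neighbour \<open>y\<close> of \<open>c\<close> either completes the
        descent, or equals \<open>b\<close>, which would then occur twice, or takes over the role of
        \<open>c\<close> in the tail.\<close>
      consider "y < b" | "y = b" | "b < y" by (rule linorder_cases)
      then show ?thesis
      proof cases
        case 1
        then have "b \<in> set ys" using ab xs subseq_imp_set_subset[of "[a, b]" ys]
          by (auto simp: subseq_singleton_left split: if_splits)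
        moreover have "x # xs = [] @ c # y # ys" using c xs by simp
        ultimately show ?thesis using 1 Cons.prems(3) by blast
      next
        case 2
        then have "b \<in> set ys" using ab xs Cons.prems(2) subseq_imp_set_subset[of "[a, b]" ys]
          by (auto simp: subseq_singleton_left split: if_splits)
        then show ?thesis using 2 Cons.prems(4) xs by simp
      next
        case 3
        then have "subseq [y, a, b] xs" using ab xs Cons.prems(2) by auto
        then show ?thesis using Cons.IH 3 Cons.prems(2,4) shift by auto
      qed
    qed
  qed
qed

section \<open>Descents and the map \<open>hat\<close>\<close>

text \<open>Applying the cycle to its own list of entries rotates that list by one place; the
  modulus wraps the last entry round to the first.\<close>

lemma cycle_of_list_nth:
  assumes "distinct cs" "i < length cs"
  shows "cycle_of_list cs (cs ! i) = cs ! (Suc i mod length cs)"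
proof -
  have "map (cycle_of_list cs) cs = rotate1 cs"
    using cyclic_rotation[OF assms(1), of 1] by simp
  then have "map (cycle_of_list cs) cs ! i = rotate1 cs ! i"
    by simp
  then show ?thesis
    using assms by (simp add: nth_rotate1)
qed

lemma hat_Nil: "hat [] = id"
  by (simp add: hat_def)

lemma hat_Cons:
  "hat (x # xs) = cycle_of_list (x # takeWhile (\<lambda>y. y < x) xs) \<circ> hat (dropWhile (\<lambda>y. y < x) xs)"
  by (simp add: hat_def)

text \<open>Needed to separate the blocks: the map of the later blocks keeps their entries among
  themselves and fixes those of the first block.\<close>

lemma hat_permutes: "hat \<pi> permutes set \<pi>"
proof (induction \<pi> rule: cycle_blocks.induct)
  case 1
  then show ?case by (metis hat_Nil permutes_id)
next
  case (2 x xs)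
  have "cycle_of_list (x # takeWhile (\<lambda>y. y < x) xs) permutes set (x # xs)"
    by (rule permutes_subset[OF cycle_permutes]) (auto dest: set_takeWhileD)
  moreover have "hat (dropWhile (\<lambda>y. y < x) xs) permutes set (x # xs)"
    by (rule permutes_subset[OF "2.IH"]) (auto dest: set_dropWhileD)
  ultimately show ?case
    unfolding hat_Cons by (rule permutes_compose[rotated])
qed

text \<open>Peel off the first block \<open>x # A\<close>. It does not affect \<open>c\<close> in a
  later block. Inside it, \<open>c\<close> goes to the next entry, or to \<open>x\<close> if it is
  last; the latter image is not below \<open>c\<close>.\<close>

lemma hat_eq_iff_descent:
  assumes "distinct \<pi>" "c \<in> set \<pi>" "a < c"
  shows "hat \<pi> c = a \<longleftrightarrow> (\<exists>us vs. \<pi> = us @ c # a # vs)"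
  using assms
proof (induction \<pi> rule: cycle_blocks.induct)
  case 1
  then show ?case by simp
next
  case (2 x xs)
  define A where "A = takeWhile (\<lambda>y. y < x) xs"
  define B where "B = dropWhile (\<lambda>y. y < x) xs"
  have xs: "xs = A @ B" by (simp add: A_def B_def)
  have A: "y < x" if "y \<in> set A" for y using that by (auto simp: A_def dest: set_takeWhileD)
  have hdB: "\<not> hd B < x" if "B \<noteq> []" using that unfolding B_def by (rule hd_dropWhile)
  have dist: "distinct (x # A)" "distinct B" "set (x # A) \<inter> set B = {}"
    using "2.prems"(1) by (auto simp: xs)
  have hat: "hat (x # xs) = cycle_of_list (x # A) \<circ> hat B"
    by (simp add: hat_Cons A_def B_def)
  show ?case
  proof (cases "c \<in> set B")
    case True
    then have "hat B c \<in> set B" using permutes_in_image[OF hat_permutes] by blast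
    then have "hat (x # xs) c = hat B c"
      using dist(3) by (auto simp: hat intro!: id_outside_supp)
    moreover have "(\<exists>us vs. B = us @ c # a # vs) \<longleftrightarrow> (\<exists>us vs. x # xs = us @ c # a # vs)"
    proof
      assume "\<exists>us vs. B = us @ c # a # vs"
      then show "\<exists>us vs. x # xs = us @ c # a # vs"
        by (metis xs append_Cons append_assoc)
    next
      assume "\<exists>us vs. x # xs = us @ c # a # vs"
      then obtain us vs where uv: "(x # A) @ B = us @ c # a # vs" by (auto simp: xs)
      have "c \<notin> set (x # A)" using True dist(3) by blast
      with uv show "\<exists>us vs. B = us @ c # a # vs"
        by (auto simp only: append_eq_append_conv2) (auto simp: append_eq_Cons_conv Cons_eq_append_conv)
    qed
    ultimately show ?thesis
      using "2.IH" True dist(2) "2.prems"(3) by (simp add: B_def)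
  next
    case False
    then have c: "c \<in> set (x # A)" using "2.prems"(2) by (auto simp: xs)
    have "hat B c = c" using False hat_permutes by (metis permutes_not_in)
    then have hc: "hat (x # xs) c = cycle_of_list (x # A) c" by (simp add: hat)
    obtain us vs where uv: "x # A = us @ c # vs" using c by (metis split_list)
    have cx: "c \<le> x" using c A by fastforce
    have "cycle_of_list (x # A) c = (if vs = [] then x else hd vs)"
    proof -
      have "(x # A) ! length us = c" "length us < length (x # A)" by (simp_all add: uv)
      then have "cycle_of_list (x # A) c = (x # A) ! (Suc (length us) mod length (x # A))"
        using cycle_of_list_nth[OF dist(1), of "length us"] by metis
      also have "\<dots> = (if vs = [] then x else hd vs)"
      proof (cases vs)
        case Nil
        then have "Suc (length us) = length (x # A)" by (simp add: uv)
        then show ?thesis using Nil by simp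
      next
        case (Cons y ys)
        then show ?thesis by (simp add: uv nth_append)
      qed
      finally show ?thesis .
    qed
    with hc have hat_c: "hat (x # xs) c = (if vs = [] then x else hd vs)" by simp
    have eq: "x # xs = us @ c # vs @ B" using uv by (simp add: xs)
    have "(\<exists>us vs. x # xs = us @ c # a # vs) \<longleftrightarrow> (\<exists>ws. vs @ B = a # ws)"
    proof
      assume "\<exists>us vs. x # xs = us @ c # a # vs"
      then obtain us' vs' where e: "x # xs = us' @ c # a # vs'" by blast
      have "us @ c # vs @ B = us' @ c # a # vs'" "distinct (us @ c # vs @ B)"
        using eq e "2.prems"(1) by simp_all
      then show "\<exists>ws. vs @ B = a # ws"
        by (metis append_Cons_eq_iff distinct_append distinct.simps(2) not_distinct_conv_prefix)
    qed (use eq in auto)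
    \<comment> \<open>If \<open>c\<close> ends its block, the next entry of the word, if any, is
      \<open>hd B\<close>, which is at least \<open>x\<close> and so exceeds
      \<open>a\<close>.\<close>
    also have "\<dots> \<longleftrightarrow> vs \<noteq> [] \<and> hd vs = a"
      using hdB cx "2.prems"(3) by (cases vs; cases B) auto
    finally show ?thesis
      using hat_c cx "2.prems"(3) by auto
  qed
qed

text \<open>The values \<open>x 1\<close>, \<open>x 2\<close>, \<open>x 3\<close> are
  \<open>a\<close>, \<open>b\<close>, \<open>c\<close>: the arrow makes \<open>c\<close>,
  \<open>a\<close> a descent, and the word 32 puts \<open>b\<close> after \<open>c\<close>.\<close>

lemma contains_32_arrow_31_iff:
  assumes "\<pi> \<in> permutations_of_set {1..n}"
  shows "contains_arrow_pattern \<pi> ([3, 2], {(3, 1)}) \<longleftrightarrow>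
    (\<exists>us c a vs b. \<pi> = us @ c # a # vs \<and> b \<in> set vs \<and> a < b \<and> b < c)"
proof -
  have \<pi>: "set \<pi> = {1..n}" "distinct \<pi>" "length \<pi> = n"
    using assms by (auto simp: permutations_of_set_def dest: distinct_card)
  have size: "pattern_size ([3, 2], {(3, 1)}) = 3"
    by (rule pattern_size_eq) auto
  show ?thesis
  proof
    assume "contains_arrow_pattern \<pi> ([3, 2], {(3, 1)})"
    then obtain x t :: "nat \<Rightarrow> nat" where x: "strict_mono_on {1..3} x" "x ` {1..3} \<subseteq> {1..n}"
      and t: "strict_mono_on {..<2} t" "t ` {..<2} \<subseteq> {..<n}"
      and nth: "\<forall>j<2. \<pi> ! t j = x ([3, 2] ! j)" and hat: "hat \<pi> (x 3) = x 1"
      unfolding contains_arrow_pattern.simps size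
      by (auto simp: \<pi>(3) numeral_2_eq_2)
    have less: "x 1 < x 2" "x 2 < x 3" "t 0 < t 1"
      using x(1) t(1) by (auto simp: strict_mono_on_def)
    have nth': "\<pi> ! t 0 = x 3" "\<pi> ! t 1 = x 2" using nth by force+
    have lt: "t 1 < n" using t(2) by (force simp: image_subset_iff)
    have "x 3 \<in> set \<pi>" using x(2) unfolding \<pi>(1) by (rule subsetD) simp
    then obtain us vs where uv: "\<pi> = us @ x 3 # x 1 # vs"
      using hat hat_eq_iff_descent[OF \<pi>(2), of "x 3" "x 1"] less by auto
    have "\<pi> ! length us = x 3" "length us < n"
      using uv \<pi>(3) by auto
    then have t0: "t 0 = length us"
      using \<pi> nth'(1) less(3) lt by (metis nth_eq_iff_index_eq order.strict_trans)
    \<comment> \<open>The place right after \<open>c\<close> holds \<open>x 1\<close>, which differs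
      from \<open>x 2\<close>; hence \<open>b\<close> lies beyond the descent.\<close>
    have "t 1 \<noteq> Suc (length us)"
      using nth'(2) less(1) uv by (auto simp: nth_append)
    then obtain k where k: "t 1 = length us + (2 + k)"
      using less(3) t0 by (metis Suc_leI add.assoc add_2_eq_Suc' add_Suc_right le_Suc_ex le_neq_implies_less)
    then have "x 2 = vs ! k" "k < length vs"
      using nth'(2) lt uv \<pi>(3) by (auto simp: nth_append)
    then show "\<exists>us c a vs b. \<pi> = us @ c # a # vs \<and> b \<in> set vs \<and> a < b \<and> b < c"
      using uv less by (metis nth_mem)
  next
    assume "\<exists>us c a vs b. \<pi> = us @ c # a # vs \<and> b \<in> set vs \<and> a < b \<and> b < c"
    then obtain us c a vs b where uv: "\<pi> = us @ c # a # vs" "b \<in> set vs" "a < b" "b < c"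
      by blast
    then obtain k where k: "k < length vs" "vs ! k = b" by (metis in_set_conv_nth)
    have hat: "hat \<pi> c = a"
      using hat_eq_iff_descent[OF \<pi>(2), of c a] uv by auto
    define x where "x i = (if i = 1 then a else if i = 2 then b else c)" for i :: nat
    \<comment> \<open>The offset 2 skips \<open>c\<close> and \<open>a\<close>, so
      \<open>t 1\<close> is the position of \<open>b\<close>, found at index \<open>k\<close> of
      \<open>vs\<close>.\<close>
    define t where "t j = (if j = 0 then length us else length us + (2 + k))" for j :: nat
    have in_range: "a \<in> {1..n}" "b \<in> {1..n}" "c \<in> {1..n}"
      using uv(1,2) \<pi>(1) by auto
    show "contains_arrow_pattern \<pi> ([3, 2], {(3, 1)})"
      unfolding contains_arrow_pattern.simps size
    proof (intro exI conjI)
      show "strict_mono_on {1..3} x"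
        using uv(3,4) by (auto simp: strict_mono_on_def x_def)
      show "x ` {1..3} \<subseteq> {1..length \<pi>}"
        using in_range by (auto simp: x_def \<pi>(3))
      show "strict_mono_on {..<length [3, 2]} t"
        by (auto simp: strict_mono_on_def t_def)
      show "t ` {..<length [3, 2]} \<subseteq> {..<length \<pi>}"
        using k by (auto simp: t_def uv(1))
      show "\<forall>j<length [3, 2]. \<pi> ! t j = x ([3, 2] ! j)"
        using k by (auto simp: t_def x_def uv(1) nth_append less_Suc_eq numeral_2_eq_2)
      show "\<forall>(b, c)\<in>{(3, 1)}. hat \<pi> (x b) = x c"
        using hat by (simp add: x_def)
    qed
  qed
qed

theorem theorem6p3:
  fixes n :: nat
  assumes "n \<ge> 1"
  shows "real (card (arrow_avoiders n ([3, 2], {(3, 1)}))) = catalan n"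
proof -
  \<comment> \<open>The arrow pattern becomes the vincular pattern and then the classical one; the
    count applies with first value 1.\<close>
  have "arrow_avoiders n ([3, 2], {(3, 1)}) = avoiders_312 {1..n}"
    using contains_32_arrow_31_iff ex_subseq_312_iff_vincular
    unfolding arrow_avoiders_def avoiders_312_def avoids_312_def
    by (smt (verit) Collect_cong permutations_of_setD(2))
  also have "{1..n} = {1..<1 + n}"
    by auto
  finally show ?thesis
    by (simp only: card_avoiders_312)
qed

end
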